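(* For every $\tau\in\mathbb{H}^2$, $$\theta'[\tfrac12,1]=\frac{\zeta_4}{4}\,\frac{\theta'[1,1]\,\theta^3[0,1]}{\theta^3[\tfrac12,1]}\qquad\text{and}\qquad \theta'[\tfrac12,0]=\frac{\zeta_4^3}{4}\,\frac{\theta'[1,1]\,\theta^3[0,1]}{\theta^3[\tfrac12,0]}.$$
   Context: $\mathbb{H}^2=\{\tau\in\mathbb{C} : \Im\tau>0\}$ is the upper half plane and $\zeta_k=\exp(2\pi i/k)$. For $\epsilon,\epsilon'\in\mathbb{R}$, $\zeta\in\mathbb{C}$, $\tau\in\mathbb{H}^2$, the theta function with characteristics is $$\theta[\epsilon,\epsilon'](\zeta,\tau)=\sum_{n\in\mathbb{Z}}\exp\left(2\pi i\left[\tfrac12\left(n+\tfrac{\epsilon}{2}\right)^2\tau+\left(n+\tfrac{\epsilon}{2}\right)\left(\zeta+\tfrac{\epsilon'}{2}\right)\right]\right).$$ Write $\theta[\epsilon,\epsilon']=\theta[\epsilon,\epsilon'](0,\tau)$ and $\theta'[\epsilon,\epsilon']=\frac{\partial}{\partial\zeta}\theta[\epsilon,\epsilon'](\zeta,\tau)\big|_{\zeta=0}$; $\theta^k[\epsilon,\epsilon']$ means the $k$-th power of $\theta[\epsilon,\epsilon']$. *)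

theory Defs
  imports "HOL-Analysis.Analysis"
begin

definition root_zeta :: "nat \<Rightarrow> complex" where
  "root_zeta k = exp (2 * complex_of_real pi * \<i> / of_nat k)"

text \<open>
  The series converges absolutely whenever \<open>Im \<tau> > 0\<close>, so for such \<open>\<tau>\<close> the unordered sum
  is the usual one; for other \<open>\<tau>\<close> the value is irrelevant.
\<close>

definition theta :: "real \<Rightarrow> real \<Rightarrow> complex \<Rightarrow> complex \<Rightarrow> complex" where
  "theta \<epsilon> \<epsilon>' \<zeta> \<tau> =
     (\<Sum>\<^sub>\<infinity>n::int.
        exp (2 * complex_of_real pi * \<i> *
          (1/2 * (of_int n + complex_of_real \<epsilon> / 2)\<^sup>2 * \<tau> +
           (of_int n + complex_of_real \<epsilon> / 2) * (\<zeta> + complex_of_real \<epsilon>' / 2))))"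

definition theta_const :: "real \<Rightarrow> real \<Rightarrow> complex \<Rightarrow> complex" where
  "theta_const \<epsilon> \<epsilon>' \<tau> = theta \<epsilon> \<epsilon>' 0 \<tau>"

definition theta_deriv :: "real \<Rightarrow> real \<Rightarrow> complex \<Rightarrow> complex" where
  "theta_deriv \<epsilon> \<epsilon>' \<tau> = deriv (\<lambda>\<zeta>. theta \<epsilon> \<epsilon>' \<zeta> \<tau>) 0"

end

theory Submission
  imports Defs
begin

text \<open>
  Write \<open>\<theta>\<^sub>2, \<theta>\<^sub>3, \<theta>\<^sub>4\<close> for the theta constants with characteristics \<open>[1,0], [0,0], [0,1]\<close> and
  \<open>\<theta>\<^sub>1'\<close> for \<open>\<theta>'[1,1]\<close>. Splitting the index set \<open>\<int>\<close> of \<open>\<theta>\<^sub>2\<close> and of \<open>\<theta>\<^sub>1'\<close> by parity, one sees that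
  at \<open>\<tau>/4\<close> they are constant multiples of \<open>\<theta>[1/2,0]\<close> and \<open>\<theta>'[1/2,0]\<close> at \<open>\<tau>\<close>. Hence the second identity,
  with its denominator cleared, is equivalent to

    \<open>\<theta>\<^sub>1'(t) \<theta>\<^sub>2(t)\<^sup>3 = 8 \<theta>\<^sub>1'(4t) \<theta>\<^sub>4(4t)\<^sup>3\<close>   with \<open>t = \<tau>/4\<close>,

  and this follows from three formulas that double the period:

    \<open>\<theta>\<^sub>1'(t) \<theta>\<^sub>2(t) = 2 \<theta>\<^sub>1'(2t) \<theta>\<^sub>4(2t)\<close>,   \<open>\<theta>\<^sub>2(t)\<^sup>2 = 2 \<theta>\<^sub>2(2t) \<theta>\<^sub>3(2t)\<close>,   \<open>\<theta>\<^sub>3(t) \<theta>\<^sub>4(t) = \<theta>\<^sub>4(2t)\<^sup>2\<close>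

  (\<open>landen_theta_deriv_11\<close>, \<open>theta_10_squared\<close>, \<open>theta_00_times_01\<close>). Each of them is a rearrangement of
  a double series: the substitution of lemma \<open>infsum_mult_rotate\<close>, essentially \<open>n = u + v\<close>, \<open>m = u - v\<close>,
  diagonalises the quadratic form in the exponent of a product of two theta series.

  To divide by \<open>\<theta>[1/2,0]\<^sup>3\<close> one has to know that \<open>\<theta>\<^sub>2\<close> has no zero in the upper half plane. The same
  formulas yield this: if \<open>\<theta>\<^sub>2, \<theta>\<^sub>3, \<theta>\<^sub>4\<close> do not vanish at \<open>2t\<close>, then they do not vanish at \<open>t\<close>, and for
  large imaginary part a single term dominates each series, that of \<open>\<theta>\<^sub>2\<close> after folding (\<open>theta_consts_nonzero\<close>).

  The first identity is the second one at \<open>\<tau> + 2\<close>, because this translation carries the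
  characteristic \<open>[1/2,0]\<close> to \<open>[1/2,1]\<close> up to a constant factor.
\<close>

section \<open>Convergence and termwise differentiation of theta series\<close>

lemma has_sum_geometric_int:
  fixes r :: real
  assumes "0 \<le> r" "r < 1"
  shows "((\<lambda>n::int. r ^ nat \<bar>n\<bar>) has_sum (1 + r) / (1 - r)) UNIV"
proof -
  have geo: "((\<lambda>k. r ^ k) has_sum 1 / (1 - r)) UNIV"
    using assms by (intro sums_nonneg_imp_has_sum geometric_sums) auto
  have pos: "((\<lambda>n::int. r ^ nat \<bar>n\<bar>) has_sum 1 / (1 - r)) {0..}"
    using geo by (subst has_sum_reindex_bij_witness[of _ int nat UNIV "\<lambda>k. r ^ k"]) auto
  have "((\<lambda>k. r ^ k * r) has_sum 1 / (1 - r) * r) UNIV"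
    by (rule has_sum_cmult_left[OF geo])
  hence neg: "((\<lambda>n::int. r ^ nat \<bar>n\<bar>) has_sum 1 / (1 - r) * r) {..<0}"
    by (subst has_sum_reindex_bij_witness[of _ "\<lambda>k. - int k - 1" "\<lambda>n. nat (- n - 1)" UNIV
          "\<lambda>k. r ^ k * r"]) (auto simp: nat_diff_distrib' simp flip: power_Suc2)
  have "((\<lambda>n::int. r ^ nat \<bar>n\<bar>) has_sum 1 / (1 - r) + 1 / (1 - r) * r) ({0..} \<union> {..<0})"
    by (rule has_sum_Un_disjoint[OF pos neg]) auto
  moreover have "{0..} \<union> {..<0} = (UNIV :: int set)" by auto
  moreover have "1 / (1 - r) + 1 / (1 - r) * r = (1 + r) / (1 - r)"
    using assms by (simp add: field_simps)
  ultimately show ?thesis by simp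
qed

text \<open>
  The linear term in the exponent absorbs both a polynomial weight (as \<open>1 + x \<le> exp x\<close>) and the
  growth of \<open>exp (2 \<pi> i x \<zeta>)\<close> for bounded \<open>\<zeta>\<close>. Completing the square turns the Gaussian into a
  geometric majorant.
\<close>

lemma gaussian_summable:
  fixes a b c :: real
  assumes "b > 0"
  shows "(\<lambda>n::int. exp (c * \<bar>real_of_int n + a\<bar> - b * (real_of_int n + a)\<^sup>2)) summable_on UNIV"
proof (rule summable_on_comparison_test)
  let ?C = "exp ((c + 1)\<^sup>2 / (4 * b) + \<bar>a\<bar>)"
  show "(\<lambda>n::int. ?C * exp (-1) ^ nat \<bar>n\<bar>) summable_on UNIV"
    by (intro summable_on_cmult_right has_sum_imp_summable[OF has_sum_geometric_int]) auto
  fix n :: int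
  let ?x = "\<bar>real_of_int n + a\<bar>"
  \<comment> \<open>completing the square in \<open>(c + 1) x - b x\<^sup>2\<close>; the extra 1 pays for the factor \<open>exp (- x)\<close>\<close>
  have "0 \<le> (2 * b * ?x - (c + 1))\<^sup>2 / (4 * b)" using assms by simp
  also have "\<dots> = (c + 1)\<^sup>2 / (4 * b) - ((c + 1) * ?x - b * ?x\<^sup>2)"
    using assms by (simp add: field_simps power2_eq_square)
  finally have "c * ?x - b * ?x\<^sup>2 \<le> (c + 1)\<^sup>2 / (4 * b) - ?x" by (simp add: algebra_simps)
  also have "\<dots> \<le> (c + 1)\<^sup>2 / (4 * b) + \<bar>a\<bar> - \<bar>real_of_int n\<bar>" by linarith
  finally have "exp (c * ?x - b * ?x\<^sup>2) \<le> ?C * exp (- \<bar>real_of_int n\<bar>)"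
    by (simp flip: exp_add)
  also have "exp (- \<bar>real_of_int n\<bar>) = exp (-1) ^ nat \<bar>n\<bar>"
    by (simp flip: exp_of_nat_mult)
  finally show "exp (c * ?x - b * (real_of_int n + a)\<^sup>2) \<le> ?C * exp (-1) ^ nat \<bar>n\<bar>"
    by simp
qed auto

definition gauss :: "real \<Rightarrow> complex \<Rightarrow> int \<Rightarrow> complex" where
  "gauss a \<tau> n = exp (complex_of_real pi * \<i> * (of_int n + complex_of_real a)\<^sup>2 * \<tau>)"

lemma norm_gauss: "norm (gauss a \<tau> n) = exp (- (pi * Im \<tau>) * (real_of_int n + a)\<^sup>2)"
proof -
  have "Re (complex_of_real pi * \<i> * (complex_of_real x)\<^sup>2 * \<tau>) = - (pi * Im \<tau>) * x\<^sup>2" for x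
    by (simp add: power2_eq_square)
  from this[of "real_of_int n + a"] show ?thesis
    unfolding gauss_def norm_exp_eq_Re by simp
qed

lemma norm_of_int_plus_half: "norm (of_int n + 1/2 :: complex) = \<bar>real_of_int n + 1/2\<bar>"
  using norm_of_real[of "real_of_int n + 1/2", where 'a = complex] by simp

lemma weighted_gauss_abs_summable:
  assumes "Im \<tau> > 0" and c: "\<And>n. norm (c n) \<le> 1 + \<bar>real_of_int n + a\<bar>"
  shows "(\<lambda>n. norm (c n * gauss a \<tau> n)) summable_on UNIV"
proof (rule Infinite_Sum.abs_summable_on_comparison_test')
  show "(\<lambda>n::int. exp (1 * \<bar>real_of_int n + a\<bar> - (pi * Im \<tau>) * (real_of_int n + a)\<^sup>2)) summable_on UNIV"
    using assms by (intro gaussian_summable) auto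
  fix n :: int
  have "norm (c n) \<le> exp \<bar>real_of_int n + a\<bar>"
    using c[of n] exp_ge_add_one_self[of "\<bar>real_of_int n + a\<bar>"] by linarith
  thus "norm (c n * gauss a \<tau> n) \<le> exp (1 * \<bar>real_of_int n + a\<bar> - (pi * Im \<tau>) * (real_of_int n + a)\<^sup>2)"
    by (simp add: norm_mult norm_gauss exp_diff exp_minus divide_inverse)
qed

text \<open>
  Near \<open>\<zeta>\<^sub>0\<close> the summands and their \<open>\<zeta>\<close>-derivatives share one summable Gaussian majorant, so the
  Weierstrass test permits differentiation under the sum. Termwise differentiation is a statement
  about sums over \<open>nat\<close>, which is why the integers are enumerated by \<open>int_decode\<close>.
\<close>

lemma has_field_derivative_theta:
  assumes "Im \<tau> > 0"
  shows "((\<lambda>\<zeta>. theta \<epsilon> \<epsilon>' \<zeta> \<tau>) has_field_derivative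
     (\<Sum>\<^sub>\<infinity>n::int. 2 * complex_of_real pi * \<i> * (of_int n + complex_of_real \<epsilon> / 2) *
        exp (2 * complex_of_real pi * \<i> *
          (1/2 * (of_int n + complex_of_real \<epsilon> / 2)\<^sup>2 * \<tau> +
           (of_int n + complex_of_real \<epsilon> / 2) * (\<zeta>0 + complex_of_real \<epsilon>' / 2))))) (at \<zeta>0)"
proof -
  define f where "f \<zeta> n = exp (2 * complex_of_real pi * \<i> *
          (1/2 * (of_int n + complex_of_real \<epsilon> / 2)\<^sup>2 * \<tau> +
           (of_int n + complex_of_real \<epsilon> / 2) * (\<zeta> + complex_of_real \<epsilon>' / 2)))" for \<zeta> and n :: int
  define f' where "f' \<zeta> n = 2 * complex_of_real pi * \<i> * (of_int n + complex_of_real \<epsilon> / 2) * f \<zeta> n"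
    for \<zeta> and n :: int
  define K where "K = 2 * pi * (norm \<zeta>0 + 1)"
  \<comment> \<open>one more \<open>\<bar>x\<bar>\<close> in the exponent covers the factor \<open>x\<close> produced by differentiation\<close>
  define M where "M n = 2 * pi * exp ((K + 1) * \<bar>real_of_int n + \<epsilon> / 2\<bar> -
      (pi * Im \<tau>) * (real_of_int n + \<epsilon> / 2)\<^sup>2)" for n
  have M: "M summable_on UNIV"
    unfolding M_def using assms by (intro summable_on_cmult_right gaussian_summable) auto
  have bound: "norm (f \<zeta> n) \<le> M n" "norm (f' \<zeta> n) \<le> M n" if "\<zeta> \<in> ball \<zeta>0 1" for \<zeta> n
  proof -
    define x where "x = real_of_int n + \<epsilon> / 2"
    have x: "of_int n + complex_of_real \<epsilon> / 2 = complex_of_real x" by (simp add: x_def)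
    have "norm \<zeta> \<le> norm \<zeta>0 + 1"
      using that norm_triangle_ineq2[of \<zeta> \<zeta>0] by (simp add: dist_norm norm_minus_commute)
    hence Im: "\<bar>Im \<zeta>\<bar> \<le> norm \<zeta>0 + 1" using abs_Im_le_cmod[of \<zeta>] by linarith
    have "Re (2 * complex_of_real pi * \<i> * (1/2 * (complex_of_real x)\<^sup>2 * \<tau> +
        complex_of_real x * (\<zeta> + complex_of_real \<epsilon>' / 2))) = - (pi * Im \<tau>) * x\<^sup>2 - 2 * pi * (x * Im \<zeta>)"
      by (simp add: power2_eq_square algebra_simps)
    moreover have "\<bar>x\<bar> * \<bar>Im \<zeta>\<bar> \<le> \<bar>x\<bar> * (norm \<zeta>0 + 1)"
      using Im by (intro mult_left_mono) auto
    hence "- (x * Im \<zeta>) \<le> \<bar>x\<bar> * (norm \<zeta>0 + 1)"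
      unfolding abs_mult[symmetric] by linarith
    hence "2 * pi * (- (x * Im \<zeta>)) \<le> 2 * pi * (\<bar>x\<bar> * (norm \<zeta>0 + 1))"
      by (intro mult_left_mono) auto
    ultimately have "norm (f \<zeta> n) \<le> exp (K * \<bar>x\<bar> - (pi * Im \<tau>) * x\<^sup>2)"
      unfolding f_def x norm_exp_eq_Re exp_le_cancel_iff K_def by (simp add: mult_ac)
    hence f: "norm (f \<zeta> n) * exp \<bar>x\<bar> \<le> exp ((K + 1) * \<bar>x\<bar> - (pi * Im \<tau>) * x\<^sup>2)"
      by (simp add: algebra_simps exp_add exp_diff divide_simps)
    have "1 \<le> 2 * pi" using pi_ge_two by simp
    have "norm (f \<zeta> n) * 1 \<le> norm (f \<zeta> n) * exp \<bar>x\<bar>" by (intro mult_left_mono) auto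
    also note f
    also have "exp ((K + 1) * \<bar>x\<bar> - (pi * Im \<tau>) * x\<^sup>2) \<le>
        2 * pi * exp ((K + 1) * \<bar>x\<bar> - (pi * Im \<tau>) * x\<^sup>2)"
      using mult_right_mono[OF \<open>1 \<le> 2 * pi\<close>] by (metis exp_ge_zero mult_1)
    finally show "norm (f \<zeta> n) \<le> M n" by (simp add: M_def x_def)
    have "norm (f' \<zeta> n) = 2 * pi * (norm (f \<zeta> n) * \<bar>x\<bar>)" unfolding f'_def x by (simp add: norm_mult)
    also have "\<dots> \<le> 2 * pi * (norm (f \<zeta> n) * exp \<bar>x\<bar>)"
      using exp_ge_add_one_self[of "\<bar>x\<bar>"] by (intro mult_left_mono) (auto simp del: exp_ge_add_one_self)
    also have "\<dots> \<le> 2 * pi * exp ((K + 1) * \<bar>x\<bar> - (pi * Im \<tau>) * x\<^sup>2)"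
      using f by (intro mult_left_mono) auto
    finally show "norm (f' \<zeta> n) \<le> M n" by (simp add: M_def x_def)
  qed
  have M': "summable (\<lambda>k. M (int_decode k))"
    using M by (intro summable_on_imp_summable) (simp add: summable_on_reindex_bij_betw[OF bij_int_decode])
  have sum_eq: "infsum g UNIV = (\<Sum>k. g (int_decode k))"
    if "\<And>n. norm (g n) \<le> M n" for g :: "int \<Rightarrow> complex"
  proof -
    have "(\<lambda>n. norm (g n)) summable_on UNIV" using M that by (rule Infinite_Sum.abs_summable_on_comparison_test')
    hence "(\<lambda>k. g (int_decode k)) summable_on UNIV"
      by (simp add: abs_summable_summable summable_on_reindex_bij_betw[OF bij_int_decode])
    hence "(\<Sum>\<^sub>\<infinity>k. g (int_decode k)) = (\<Sum>k. g (int_decode k))"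
      using has_sum_imp_sums has_sum_infsum sums_unique by metis
    thus ?thesis by (simp add: infsum_reindex_bij_betw[OF bij_int_decode])
  qed
  have "((\<lambda>\<zeta>. \<Sum>k. f \<zeta> (int_decode k)) has_field_derivative (\<Sum>k. f' \<zeta>0 (int_decode k))) (at \<zeta>0)"
  proof (rule has_field_derivative_series'(2)[where S = "ball \<zeta>0 1" and ?x0.0 = \<zeta>0])
    show "((\<lambda>\<zeta>. f \<zeta> (int_decode k)) has_field_derivative f' \<zeta> (int_decode k)) (at \<zeta> within ball \<zeta>0 1)" for k \<zeta>
      unfolding f_def f'_def by (auto intro!: derivative_eq_intros)
    show "uniformly_convergent_on (ball \<zeta>0 1) (\<lambda>n \<zeta>. \<Sum>k<n. f' \<zeta> (int_decode k))"
      by (rule Weierstrass_m_test'[OF _ M']) (use bound in auto)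
    show "summable (\<lambda>k. f \<zeta>0 (int_decode k))"
      by (rule summable_comparison_test'[OF M', of 0]) (use bound in auto)
  qed auto
  hence deriv: "((\<lambda>\<zeta>. \<Sum>k. f \<zeta> (int_decode k)) has_field_derivative infsum (f' \<zeta>0) UNIV) (at \<zeta>0)"
    using bound by (simp add: sum_eq)
  have "theta \<epsilon> \<epsilon>' \<zeta> \<tau> = infsum (f \<zeta>) UNIV" for \<zeta>
    by (simp only: theta_def f_def[abs_def])
  hence th: "(\<Sum>k. f \<zeta> (int_decode k)) = theta \<epsilon> \<epsilon>' \<zeta> \<tau>" if "\<zeta> \<in> ball \<zeta>0 1" for \<zeta>
    using bound(1)[OF that] by (simp add: sum_eq)
  have ev: "eventually (\<lambda>\<zeta>. (\<Sum>k. f \<zeta> (int_decode k)) = theta \<epsilon> \<epsilon>' \<zeta> \<tau>) (nhds \<zeta>0)"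
    unfolding eventually_nhds
    by (rule exI[of _ "ball \<zeta>0 1"]) (use th in auto)
  show ?thesis
    using deriv unfolding DERIV_cong_ev[OF refl ev refl] by (simp only: f'_def[abs_def] f_def)
qed

section \<open>The theta constants as weighted Gaussian sums\<close>

lemma exp_pi_i_int: "exp (complex_of_real pi * \<i> * of_int n) = (-1) powi n"
proof -
  have "(-1) powi n = exp (complex_of_real pi * \<i>) powi n" by simp
  thus ?thesis by (simp only: exp_power_int mult_ac)
qed

lemma norm_minus_one_powi [simp]: "norm ((-1::complex) powi n) = 1"
  by (simp add: norm_power_int)

lemma minus_one_powi_reflect: "(-1::complex) powi (- 1 - n) = - ((-1) powi n)"
  using power_int_minus_one_diff_commute[of "-1" n, where 'a = complex] by (simp add: power_int_add)

lemma theta_summand_at_0: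
  "exp (2 * complex_of_real pi * \<i> * (1/2 * x\<^sup>2 * \<tau> + x * (0 + e / 2))) =
     exp (complex_of_real pi * \<i> * e * x) * exp (complex_of_real pi * \<i> * x\<^sup>2 * \<tau>)"
  unfolding exp_add[symmetric] by (simp add: ring_distribs mult_ac add_ac)

text \<open>
  At \<open>\<zeta> = 0\<close> the characteristic \<open>\<epsilon>'\<close> contributes a factor independent of \<open>\<tau>\<close>. Separating it from the
  Gaussian factor lets the product formulas below treat these weights and the quadratic exponents
  independently.
\<close>

lemma theta_const_series:
  "theta_const \<epsilon> \<epsilon>' \<tau> = (\<Sum>\<^sub>\<infinity>n. exp (complex_of_real pi * \<i> * of_real \<epsilon>' * (of_int n + of_real \<epsilon> / 2)) *
      gauss (\<epsilon> / 2) \<tau> n)"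
  unfolding theta_const_def theta_def theta_summand_at_0 gauss_def by simp

lemma theta_deriv_series:
  assumes "Im \<tau> > 0"
  shows "theta_deriv \<epsilon> \<epsilon>' \<tau> = 2 * of_real pi * \<i> * (\<Sum>\<^sub>\<infinity>n. (of_int n + of_real \<epsilon> / 2) *
      exp (complex_of_real pi * \<i> * of_real \<epsilon>' * (of_int n + of_real \<epsilon> / 2)) * gauss (\<epsilon> / 2) \<tau> n)"
  unfolding theta_deriv_def DERIV_imp_deriv[OF has_field_derivative_theta[OF assms]] gauss_def
    theta_summand_at_0 infsum_cmult_right'[symmetric] by (simp only: mult.assoc of_real_divide of_real_numeral)

lemma gauss_abs_summable:
  assumes "Im \<tau> > 0" and c: "\<And>n. norm (c n) \<le> 1"
  shows "(\<lambda>n. norm (c n * gauss a \<tau> n)) summable_on UNIV"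
  using order_trans[OF c] by (intro weighted_gauss_abs_summable assms) simp

lemma
  shows theta_00: "theta_const 0 0 \<tau> = (\<Sum>\<^sub>\<infinity>n. gauss 0 \<tau> n)"
    and theta_10: "theta_const 1 0 \<tau> = (\<Sum>\<^sub>\<infinity>n. gauss (1/2) \<tau> n)"
    and theta_01: "theta_const 0 1 \<tau> = (\<Sum>\<^sub>\<infinity>n. (-1) powi n * gauss 0 \<tau> n)"
    and theta_half_0: "theta_const (1/2) 0 \<tau> = (\<Sum>\<^sub>\<infinity>n. gauss (1/4) \<tau> n)"
  by (simp_all add: theta_const_series exp_pi_i_int)

lemma exp_pi_i_half: "exp (complex_of_real pi * \<i> * (of_int n + 1 / 2)) = \<i> * (-1) powi n"
proof -
  have "exp (complex_of_real pi * \<i> * (of_int n + 1 / 2)) =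
      exp (complex_of_real pi * \<i> * of_int n) * exp (\<i> * complex_of_real (pi / 2))"
    unfolding exp_add[symmetric] by (simp add: algebra_simps)
  also have "exp (\<i> * complex_of_real (pi / 2)) = \<i>" by (simp add: exp_Euler cos_of_real sin_of_real del: of_real_divide)
  finally show ?thesis by (simp add: exp_pi_i_int)
qed

lemma theta_deriv_11:
  assumes "Im \<tau> > 0"
  shows "theta_deriv 1 1 \<tau> =
      - 2 * of_real pi * (\<Sum>\<^sub>\<infinity>n. (of_int n + 1 / 2) * (-1) powi n * gauss (1/2) \<tau> n)"
proof -
  have "(\<Sum>\<^sub>\<infinity>n. (of_int n + of_real 1 / 2) *
      exp (complex_of_real pi * \<i> * of_real 1 * (of_int n + of_real 1 / 2)) * gauss (1 / 2) \<tau> n)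
     = (\<Sum>\<^sub>\<infinity>n. \<i> * ((of_int n + 1 / 2) * (-1) powi n * gauss (1/2) \<tau> n))"
    by (intro infsum_cong) (simp add: exp_pi_i_half)
  also have "\<dots> = \<i> * (\<Sum>\<^sub>\<infinity>n. (of_int n + 1 / 2) * (-1) powi n * gauss (1/2) \<tau> n)"
    by (rule infsum_cmult_right')
  finally have "(\<Sum>\<^sub>\<infinity>n. (of_int n + of_real 1 / 2) *
      exp (complex_of_real pi * \<i> * of_real 1 * (of_int n + of_real 1 / 2)) * gauss (1 / 2) \<tau> n)
     = \<i> * (\<Sum>\<^sub>\<infinity>n. (of_int n + 1 / 2) * (-1) powi n * gauss (1/2) \<tau> n)" .
  moreover have "2 * P * \<i> * (\<i> * X) = - 2 * P * X" for P X :: complex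
    by simp
  ultimately show ?thesis
    unfolding theta_deriv_series[OF assms] by metis
qed

lemma theta_deriv_half_0:
  assumes "Im \<tau> > 0"
  shows "theta_deriv (1/2) 0 \<tau> = 2 * of_real pi * \<i> * (\<Sum>\<^sub>\<infinity>n. (of_int n + 1 / 4) * gauss (1/4) \<tau> n)"
  unfolding theta_deriv_series[OF assms] by simp

section \<open>Products of sums over the integers\<close>

lemma infsum_odd_eq_0:
  fixes f :: "int \<Rightarrow> complex"
  assumes "\<And>n. f (c - n) = - f n"
  shows "infsum f UNIV = 0"
proof -
  have "infsum f UNIV = (\<Sum>\<^sub>\<infinity>n. - f n)"
    by (rule infsum_reindex_bij_witness[of _ "\<lambda>n. c - n" "\<lambda>n. c - n"]) (auto simp: assms)
  thus ?thesis by (simp add: infsum_uminus)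
qed

lemma
  fixes f g :: "int \<Rightarrow> complex"
  assumes f: "(\<lambda>n. norm (f n)) summable_on UNIV" and g: "(\<lambda>n. norm (g n)) summable_on UNIV"
  shows abs_summable_mult_pair: "(\<lambda>p. norm (f (fst p) * g (snd p))) summable_on UNIV"
    and infsum_mult_pair: "(\<Sum>\<^sub>\<infinity>p. f (fst p) * g (snd p)) = infsum f UNIV * infsum g UNIV"
proof -
  have "(\<lambda>p. norm (f (fst p)) * norm (g (snd p))) summable_on UNIV \<times> UNIV"
    by (rule summable_on_SigmaI[where g = "\<lambda>x. norm (f x) * (\<Sum>\<^sub>\<infinity>y. norm (g y))"])
       (auto intro!: has_sum_cmult_right has_sum_infsum summable_on_cmult_left f g)
  thus 1: "(\<lambda>p. norm (f (fst p) * g (snd p))) summable_on UNIV" by (simp add: norm_mult)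
  hence "(\<lambda>p. f (fst p) * g (snd p)) summable_on UNIV \<times> UNIV"
    by (simp add: abs_summable_summable)
  from infsum_Sigma_banach[OF this]
  show "(\<Sum>\<^sub>\<infinity>p. f (fst p) * g (snd p)) = infsum f UNIV * infsum g UNIV"
    by (simp add: infsum_cmult_right' infsum_cmult_left')
qed

text \<open>
  The pairs \<open>(n, m)\<close> with \<open>n + m\<close> even are exactly the \<open>(u + v, u - v)\<close>, those with \<open>n + m\<close> odd exactly
  the \<open>(u + v, v - u - 1)\<close>. Since \<open>n\<^sup>2 + m\<^sup>2 = ((n + m)\<^sup>2 + (n - m)\<^sup>2) / 2\<close>, this change of variables is a
  rotation followed by a scaling: it separates \<open>u\<close> from \<open>v\<close> again in a product of Gaussian terms.
\<close>

lemma infsum_mult_rotate: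
  fixes f g :: "int \<Rightarrow> complex"
  assumes f: "(\<lambda>n. norm (f n)) summable_on UNIV" and g: "(\<lambda>n. norm (g n)) summable_on UNIV"
  shows "infsum f UNIV * infsum g UNIV =
      (\<Sum>\<^sub>\<infinity>(u, v). f (u + v) * g (u - v)) + (\<Sum>\<^sub>\<infinity>(u, v). f (u + v) * g (v - u - 1))"
proof -
  let ?F = "\<lambda>p. f (fst p) * g (snd p)"
  let ?E = "{p :: int \<times> int. even (fst p + snd p)}"
  have even_split: "(n + m) div 2 + (n - m) div 2 = n" "(n + m) div 2 - (n - m) div 2 = m"
    if "even (n + m)" for n m :: int using that by presburger+
  have odd_split: "(n - m - 1) div 2 + (n + m + 1) div 2 = n" "(n + m + 1) div 2 - (n - m - 1) div 2 - 1 = m"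
    if "odd (n + m)" for n m :: int using that by presburger+
  have F: "?F summable_on A" for A
    by (rule summable_on_subset_banach[OF abs_summable_summable[OF abs_summable_mult_pair[OF f g]]]) simp
  have "infsum f UNIV * infsum g UNIV = infsum ?F (?E \<union> - ?E)"
    by (simp add: infsum_mult_pair[OF f g])
  also have "\<dots> = infsum ?F ?E + infsum ?F (- ?E)"
    by (rule infsum_Un_disjoint[OF F F]) auto
  also have "infsum ?F ?E = (\<Sum>\<^sub>\<infinity>(u, v). f (u + v) * g (u - v))"
  proof (rule infsum_reindex_bij_witness[of UNIV "\<lambda>(n, m). ((n + m) div 2, (n - m) div 2)"
        "\<lambda>(u, v). (u + v, u - v)", symmetric])
    fix p :: "int \<times> int"
    show "(\<lambda>(n, m). ((n + m) div 2, (n - m) div 2)) ((\<lambda>(u, v). (u + v, u - v)) p) = p"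
      by (cases p) simp
    show "?F ((\<lambda>(u, v). (u + v, u - v)) p) = (case p of (u, v) \<Rightarrow> f (u + v) * g (u - v))"
      by (cases p) simp
    show "(\<lambda>(u, v). (u + v, u - v)) p \<in> ?E"
      by (cases p) simp
    show "(\<lambda>(u, v). (u + v, u - v)) ((\<lambda>(n, m). ((n + m) div 2, (n - m) div 2)) p) = p" if "p \<in> ?E"
      using that by (cases p) (simp add: even_split)
  qed simp
  also have "infsum ?F (- ?E) = (\<Sum>\<^sub>\<infinity>(u, v). f (u + v) * g (v - u - 1))"
  proof (rule infsum_reindex_bij_witness[of UNIV "\<lambda>(n, m). ((n - m - 1) div 2, (n + m + 1) div 2)"
        "\<lambda>(u, v). (u + v, v - u - 1)", symmetric])
    fix p :: "int \<times> int"
    show "(\<lambda>(n, m). ((n - m - 1) div 2, (n + m + 1) div 2)) ((\<lambda>(u, v). (u + v, v - u - 1)) p) = p"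
      by (cases p) simp
    show "?F ((\<lambda>(u, v). (u + v, v - u - 1)) p) = (case p of (u, v) \<Rightarrow> f (u + v) * g (v - u - 1))"
      by (cases p) simp
    show "(\<lambda>(u, v). (u + v, v - u - 1)) p \<in> - ?E"
      by (cases p) auto
    show "(\<lambda>(u, v). (u + v, v - u - 1)) ((\<lambda>(n, m). ((n - m - 1) div 2, (n + m + 1) div 2)) p) = p"
      if "p \<in> - ?E"
      using that odd_split[of "fst p" "snd p"] by (simp add: case_prod_unfold del: even_add odd_add)
  qed simp
  finally show ?thesis .
qed

text \<open>
  The factor 2 between the quadratic forms is what doubles the period.
\<close>

lemma gauss_mult_gauss:
  assumes "(real_of_int n + a)\<^sup>2 + (real_of_int m + b)\<^sup>2 = 2 * ((real_of_int u + c)\<^sup>2 + (real_of_int v + d)\<^sup>2)"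
  shows "gauss a \<tau> n * gauss b \<tau> m = gauss c (2 * \<tau>) u * gauss d (2 * \<tau>) v"
proof -
  have "(of_int n + complex_of_real a)\<^sup>2 + (of_int m + complex_of_real b)\<^sup>2 =
      2 * ((of_int u + complex_of_real c)\<^sup>2 + (of_int v + complex_of_real d)\<^sup>2)"
    using arg_cong[OF assms, of complex_of_real] by simp
  hence "complex_of_real pi * \<i> * \<tau> * ((of_int n + complex_of_real a)\<^sup>2 + (of_int m + complex_of_real b)\<^sup>2) =
      complex_of_real pi * \<i> * \<tau> * (2 * ((of_int u + complex_of_real c)\<^sup>2 + (of_int v + complex_of_real d)\<^sup>2))"
    by simp
  thus ?thesis unfolding gauss_def exp_add[symmetric] by (simp add: algebra_simps)
qed

lemma gauss_cong:
  assumes "(real_of_int n + a)\<^sup>2 = (real_of_int m + b)\<^sup>2"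
  shows "gauss a \<tau> n = gauss b \<tau> m"
proof -
  have "(of_int n + complex_of_real a)\<^sup>2 = (of_int m + complex_of_real b)\<^sup>2"
    using arg_cong[OF assms, of complex_of_real] by simp
  thus ?thesis by (simp add: gauss_def)
qed

section \<open>Doubling the period\<close>

text \<open>
  Both parity classes of the double sum contribute the same product.
\<close>

lemma theta_10_squared:
  assumes "Im \<tau> > 0"
  shows "theta_const 1 0 \<tau> ^ 2 = 2 * theta_const 1 0 (2 * \<tau>) * theta_const 0 0 (2 * \<tau>)"
proof -
  have s: "(\<lambda>n. norm (gauss a t n)) summable_on UNIV" if "Im t > 0" for a t
    using gauss_abs_summable[OF that, of "\<lambda>_. 1"] by simp
  have *: "(\<Sum>\<^sub>\<infinity>(u, v). gauss (1/2) (2 * \<tau>) u * gauss 0 (2 * \<tau>) v)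
      = theta_const 1 0 (2 * \<tau>) * theta_const 0 0 (2 * \<tau>)"
    using infsum_mult_pair[OF s s, of "2 * \<tau>" "2 * \<tau>" "1/2" 0] assms
    by (simp add: theta_10 theta_00 case_prod_unfold)
  have "gauss (1/2) \<tau> (u + v) * gauss (1/2) \<tau> (u - v) = gauss (1/2) (2 * \<tau>) u * gauss 0 (2 * \<tau>) v"
       "gauss (1/2) \<tau> (u + v) * gauss (1/2) \<tau> (v - u - 1) = gauss (1/2) (2 * \<tau>) u * gauss 0 (2 * \<tau>) v"
    for u v
    by (rule gauss_mult_gauss, simp add: power2_eq_square field_simps)+
  thus ?thesis
    unfolding power2_eq_square theta_10[of \<tau>] infsum_mult_rotate[OF s[OF assms] s[OF assms]]
    by (simp add: *)
qed

text \<open>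
  Only the even class survives: on the odd class the double sum factors, and its sum over \<open>u\<close>
  vanishes because \<open>u \<mapsto> - 1 - u\<close> preserves the Gaussian term and flips the sign \<open>(-1)\<^sup>u\<close>.
\<close>

lemma theta_00_times_01:
  assumes "Im \<tau> > 0"
  shows "theta_const 0 0 \<tau> * theta_const 0 1 \<tau> = theta_const 0 1 (2 * \<tau>) ^ 2"
proof -
  let ?f = "\<lambda>n. (-1) powi n * gauss 0 \<tau> n"
  let ?e = "\<lambda>n. (-1) powi n * gauss 0 (2 * \<tau>) n"
  let ?o = "\<lambda>n. (-1) powi n * gauss (1/2) (2 * \<tau>) n"
  let ?o' = "\<lambda>n. (-1) powi n * gauss (-1/2) (2 * \<tau>) n"
  have s: "(\<lambda>n. norm ((-1) powi n * gauss a t n)) summable_on UNIV" if "Im t > 0" for a t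
    using that by (intro gauss_abs_summable) simp_all
  have s0: "(\<lambda>n. norm (gauss 0 \<tau> n)) summable_on UNIV"
    using gauss_abs_summable[OF assms, of "\<lambda>_. 1"] by simp
  have e: "?f (u + v) * gauss 0 \<tau> (u - v) = ?e u * ?e v" for u v
  proof -
    have "gauss 0 \<tau> (u + v) * gauss 0 \<tau> (u - v) = gauss 0 (2 * \<tau>) u * gauss 0 (2 * \<tau>) v"
      by (rule gauss_mult_gauss) (simp add: power2_eq_square algebra_simps)
    thus ?thesis by (simp add: power_int_add mult_ac)
  qed
  have o: "?f (u + v) * gauss 0 \<tau> (v - u - 1) = ?o u * ?o' v" for u v
  proof -
    have "gauss 0 \<tau> (u + v) * gauss 0 \<tau> (v - u - 1) = gauss (1/2) (2 * \<tau>) u * gauss (-1/2) (2 * \<tau>) v"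
      by (rule gauss_mult_gauss) (simp add: power2_eq_square field_simps)
    thus ?thesis by (simp add: power_int_add mult_ac)
  qed
  have reflect: "gauss (1/2) t (- 1 - n) = gauss (1/2) t n" for t n
    by (rule gauss_cong) (simp add: power2_eq_square field_simps)
  have "infsum ?o UNIV = 0"
    by (rule infsum_odd_eq_0[of _ "-1"]) (simp add: reflect minus_one_powi_reflect)
  hence "(\<Sum>\<^sub>\<infinity>(u, v). ?o u * ?o' v) = 0"
    using infsum_mult_pair[OF s s, of "2 * \<tau>" "2 * \<tau>" "1/2" "-1/2"] assms
    by (simp add: case_prod_unfold)
  moreover have "(\<Sum>\<^sub>\<infinity>(u, v). ?e u * ?e v) = theta_const 0 1 (2 * \<tau>) ^ 2"
    using infsum_mult_pair[OF s s, of "2 * \<tau>" "2 * \<tau>" 0 0] assms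
    by (simp add: case_prod_unfold theta_01 power2_eq_square)
  moreover have "theta_const 0 0 \<tau> * theta_const 0 1 \<tau> = infsum ?f UNIV * infsum (gauss 0 \<tau>) UNIV"
    by (simp add: theta_00 theta_01)
  ultimately show ?thesis
    unfolding infsum_mult_rotate[OF s[OF assms] s0] by (simp only: e o add_0_right)
qed

text \<open>
  This is the value at \<open>\<zeta> = 0\<close> of the derivative of Landen's transformation
  \<open>\<theta>[1,1](\<zeta>,\<tau>) \<theta>[1,0](\<zeta>,\<tau>) = \<theta>[1,1](2\<zeta>,2\<tau>) \<theta>[0,1](0,2\<tau>)\<close>. In the double sum the weight
  \<open>n + 1/2\<close> becomes \<open>(u + 1/2) + v\<close>. The first part produces the right-hand side and the second
  cancels, being odd in \<open>v\<close>.
\<close>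

lemma landen_theta_deriv_11:
  assumes "Im \<tau> > 0"
  shows "theta_deriv 1 1 \<tau> * theta_const 1 0 \<tau> = 2 * theta_deriv 1 1 (2 * \<tau>) * theta_const 0 1 (2 * \<tau>)"
proof -
  let ?d = "\<lambda>\<tau> n. (of_int n + 1/2) * (-1) powi n * gauss (1/2) \<tau> n"
  let ?e = "\<lambda>n. (-1) powi n * gauss 0 (2 * \<tau>) n"
  let ?h = "\<lambda>n. (-1) powi n * gauss (1/2) (2 * \<tau>) n"
  let ?k = "\<lambda>n. of_int n * (-1) powi n * gauss 0 (2 * \<tau>) n"
  let ?T = "\<lambda>(u, v). ?d (2 * \<tau>) u * ?e v + ?h u * ?k v"
  have \<tau>2: "Im (2 * \<tau>) > 0" using assms by simp
  have d: "(\<lambda>n. norm (?d t n)) summable_on UNIV" if "Im t > 0" for t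
    by (rule weighted_gauss_abs_summable[OF that]) (simp add: norm_mult norm_of_int_plus_half)
  have k: "(\<lambda>n. norm (?k n)) summable_on UNIV"
    by (rule weighted_gauss_abs_summable[OF \<tau>2]) (simp add: norm_mult)
  have e: "(\<lambda>n. norm (?e n)) summable_on UNIV" and h: "(\<lambda>n. norm (?h n)) summable_on UNIV"
    by (rule gauss_abs_summable[OF \<tau>2]; simp)+
  have g: "(\<lambda>n. norm (gauss (1/2) \<tau> n)) summable_on UNIV"
    using gauss_abs_summable[OF assms, of "\<lambda>_. 1"] by simp
  have "gauss (1/2) \<tau> (u + v) * gauss (1/2) \<tau> (u - v) = gauss (1/2) (2 * \<tau>) u * gauss 0 (2 * \<tau>) v"
       "gauss (1/2) \<tau> (u + v) * gauss (1/2) \<tau> (v - u - 1) = gauss (1/2) (2 * \<tau>) u * gauss 0 (2 * \<tau>) v"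
    for u v
    by (rule gauss_mult_gauss, simp add: power2_eq_square field_simps)+
  hence "(of_int (u + v) + 1/2) * (-1) powi (u + v) * (gauss (1/2) \<tau> (u + v) * gauss (1/2) \<tau> (u - v)) = ?T (u, v)"
    "(of_int (u + v) + 1/2) * (-1) powi (u + v) * (gauss (1/2) \<tau> (u + v) * gauss (1/2) \<tau> (v - u - 1)) = ?T (u, v)"
    for u v
    by (simp_all add: power_int_add ring_distribs mult_ac add_ac)
  hence eq: "infsum (?d \<tau>) UNIV * infsum (gauss (1/2) \<tau>) UNIV = 2 * infsum ?T UNIV"
    unfolding infsum_mult_rotate[OF d[OF assms] g] by (simp only: mult.assoc mult_2 cond_case_prod_eta)
  have "infsum ?T UNIV = (\<Sum>\<^sub>\<infinity>p. ?d (2 * \<tau>) (fst p) * ?e (snd p)) + (\<Sum>\<^sub>\<infinity>p. ?h (fst p) * ?k (snd p))"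
    unfolding case_prod_unfold
    by (rule infsum_add[OF abs_summable_summable[OF abs_summable_mult_pair[OF d[OF \<tau>2] e]]
          abs_summable_summable[OF abs_summable_mult_pair[OF h k]]])
  also have "\<dots> = infsum (?d (2 * \<tau>)) UNIV * infsum ?e UNIV + infsum ?h UNIV * infsum ?k UNIV"
    unfolding infsum_mult_pair[OF d[OF \<tau>2] e] infsum_mult_pair[OF h k] by (rule refl)
  also have "infsum ?k UNIV = 0"
  proof (rule infsum_odd_eq_0[of _ 0])
    fix n
    have "gauss 0 (2 * \<tau>) (- n) = gauss 0 (2 * \<tau>) n" by (rule gauss_cong) simp
    thus "?k (0 - n) = - ?k n" by (simp add: power_int_minus_one_minus)
  qed
  finally have "infsum (?d \<tau>) UNIV * infsum (gauss (1/2) \<tau>) UNIV = 2 * (infsum (?d (2 * \<tau>)) UNIV * infsum ?e UNIV)"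
    unfolding eq by (simp only: mult_zero_right add_0_right)
  note eq' = this
  \<comment> \<open>insert the common factor \<open>- 2 \<pi>\<close> of the two derivatives\<close>
  have alg: "- 2 * P * D * G = 2 * (- 2 * P * D') * E" if "D * G = 2 * (D' * E)" for P D D' G E :: complex
    using that by algebra
  show ?thesis
    unfolding theta_deriv_11[OF assms] theta_deriv_11[OF \<tau>2] theta_10 theta_01 by (rule alg[OF eq'])
qed

text \<open>
  The derivative identity is used twice, at \<open>\<tau>\<close> and at \<open>2 \<tau>\<close>. Between the two uses,
  \<open>\<theta>[1,0](\<tau>)\<^sup>2\<close> supplies the factor \<open>\<theta>[1,0](2 \<tau>)\<close> that the second one consumes and the factor
  \<open>\<theta>[0,0](2 \<tau>)\<close> that combines with \<open>\<theta>[0,1](2 \<tau>)\<close> to \<open>\<theta>[0,1](4 \<tau>)\<^sup>2\<close>.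
\<close>

lemma theta_deriv_11_times_10_cubed:
  assumes "Im \<tau> > 0"
  shows "theta_deriv 1 1 \<tau> * theta_const 1 0 \<tau> ^ 3 = 8 * theta_deriv 1 1 (4 * \<tau>) * theta_const 0 1 (4 * \<tau>) ^ 3"
proof -
  have \<tau>2: "Im (2 * \<tau>) > 0" using assms by simp
  have "D * T ^ 3 = 8 * D4 * F4 ^ 3"
    if "D * T = 2 * D2 * F2" "T ^ 2 = 2 * T2 * Z2" "D2 * T2 = 2 * D4 * F4" "Z2 * F2 = F4 ^ 2"
    for D T D2 F2 T2 Z2 D4 F4 :: complex
  proof -
    have "D * T ^ 3 = (D * T) * T ^ 2" by (simp add: power3_eq_cube power2_eq_square)
    also have "\<dots> = 4 * (D2 * T2) * (Z2 * F2)" unfolding that(1,2) by (simp add: mult_ac)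
    also have "\<dots> = 8 * D4 * F4 ^ 3" unfolding that(3,4) by (simp add: power3_eq_cube power2_eq_square)
    finally show ?thesis .
  qed
  from this[OF landen_theta_deriv_11[OF assms] theta_10_squared[OF assms]
      landen_theta_deriv_11[OF \<tau>2] theta_00_times_01[OF \<tau>2]]
  show ?thesis by simp
qed

section \<open>From characteristic 1 to characteristic 1/2\<close>

text \<open>
  The odd integers are enumerated in the reversed order \<open>- 2 m - 1\<close> because then
  \<open>n + 1/2 = \<plusminus> 2 (m + 1/4)\<close> in both classes, so that a sum of Gaussian terms over \<open>\<int> + 1/2\<close> folds onto twice the
  sum over \<open>\<int> + 1/4\<close>.
\<close>

lemma infsum_int_fold:
  fixes f :: "int \<Rightarrow> complex"
  assumes "f summable_on UNIV"
  shows "infsum f UNIV = (\<Sum>\<^sub>\<infinity>m. f (2 * m)) + (\<Sum>\<^sub>\<infinity>m. f (- 2 * m - 1))"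
proof -
  have s: "f summable_on A" for A
    using assms by (rule summable_on_subset_banach) simp
  have "UNIV = {n :: int. even n} \<union> {n. odd n}" by auto
  hence "infsum f UNIV = infsum f {n. even n} + infsum f {n. odd n}"
    using infsum_Un_disjoint[OF s s, of "{n. even n}" "{n. odd n}"] by auto
  also have "infsum f {n. even n} = (\<Sum>\<^sub>\<infinity>m. f (2 * m))"
    by (rule infsum_reindex_bij_witness[of _ "\<lambda>m. 2 * m" "\<lambda>n. n div 2"]) auto
  also have "infsum f {n. odd n} = (\<Sum>\<^sub>\<infinity>m. f (- 2 * m - 1))"
  proof (rule infsum_reindex_bij_witness[of _ "\<lambda>m. - 2 * m - 1" "\<lambda>n. (- n - 1) div 2"])
    show odd: "- 2 * ((- n - 1) div 2) - 1 = n" if "n \<in> {n. odd n}" for n :: int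
      using that unfolding mem_Collect_eq by presburger
    show "f (- 2 * ((- n - 1) div 2) - 1) = f n" if "n \<in> {n. odd n}" for n :: int
      using odd[OF that] by simp
    show "(- (- 2 * m - 1) - 1) div 2 = m" for m :: int by simp
  qed auto
  finally show ?thesis .
qed

lemma gauss_quarter:
  assumes "(real_of_int n + a)\<^sup>2 = 4 * (real_of_int m + b)\<^sup>2"
  shows "gauss a (\<tau> / 4) n = gauss b \<tau> m"
proof -
  have "(of_int n + complex_of_real a)\<^sup>2 = 4 * (of_int m + complex_of_real b)\<^sup>2"
    using arg_cong[OF assms, of complex_of_real] by simp
  thus ?thesis by (simp add: gauss_def mult_ac)
qed

lemma
  shows gauss_half_quarter_even: "gauss (1/2) (\<tau> / 4) (2 * m) = gauss (1/4) \<tau> m"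
    and gauss_half_quarter_odd: "gauss (1/2) (\<tau> / 4) (- 2 * m - 1) = gauss (1/4) \<tau> m"
  by (rule gauss_quarter, simp add: power2_eq_square field_simps)+

lemma theta_10_quarter:
  assumes "Im \<tau> > 0"
  shows "theta_const 1 0 (\<tau> / 4) = 2 * theta_const (1/2) 0 \<tau>"
proof -
  have "(\<lambda>n. gauss (1/2) (\<tau> / 4) n) summable_on UNIV"
    using gauss_abs_summable[of "\<tau> / 4" "\<lambda>_. 1"] assms by (simp add: abs_summable_summable)
  thus ?thesis
    unfolding theta_10 theta_half_0
    by (subst infsum_int_fold) (simp_all only: gauss_half_quarter_even gauss_half_quarter_odd, simp)
qed

text \<open>
  For odd \<open>n = - 2 m - 1\<close> the weight \<open>n + 1/2\<close> equals \<open>- 2 (m + 1/4)\<close>, and \<open>(-1)\<^sup>n\<close> cancels its sign. So the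
  even and the odd half of the derivative series add up instead of cancelling.
\<close>

lemma theta_deriv_11_quarter:
  assumes "Im \<tau> > 0"
  shows "theta_deriv 1 1 (\<tau> / 4) = 4 * \<i> * theta_deriv (1/2) 0 \<tau>"
proof -
  let ?f = "\<lambda>n. (of_int n + 1/2) * (-1) powi n * gauss (1/2) (\<tau> / 4) n"
  let ?g = "\<lambda>m. (of_int m + 1/4) * gauss (1/4) \<tau> m"
  have \<tau>4: "Im (\<tau> / 4) > 0" using assms by simp
  have "(\<lambda>n. norm (?f n)) summable_on UNIV"
    by (rule weighted_gauss_abs_summable[OF \<tau>4]) (simp add: norm_mult norm_of_int_plus_half)
  hence "infsum ?f UNIV = (\<Sum>\<^sub>\<infinity>m. ?f (2 * m)) + (\<Sum>\<^sub>\<infinity>m. ?f (- 2 * m - 1))"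
    by (rule infsum_int_fold[OF abs_summable_summable])
  also have "(\<lambda>m. ?f (2 * m)) = (\<lambda>m. 2 * ?g m)"
  proof
    fix m :: int
    have "(-1 :: complex) powi (2 * m) = 1"
      by (simp add: power_int_mult)
    moreover have "(of_int (2 * m) + 1/2) * 1 = (2 * (of_int m + 1/4) :: complex)"
      by simp
    ultimately show "?f (2 * m) = 2 * ?g m"
      unfolding gauss_half_quarter_even by (simp only: mult.assoc)
  qed
  also have "(\<lambda>m. ?f (- 2 * m - 1)) = (\<lambda>m. 2 * ?g m)"
  proof
    fix m :: int
    have "(-1 :: complex) powi (- 2 * m - 1) = -1"
      by (simp add: power_int_diff power_int_mult power_int_minus)
    moreover have "(of_int (- 2 * m - 1) + 1/2) * -1 = (2 * (of_int m + 1/4) :: complex)"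
      by simp
    ultimately show "?f (- 2 * m - 1) = 2 * ?g m"
      unfolding gauss_half_quarter_odd by (simp only: mult.assoc)
  qed
  also have "(\<Sum>\<^sub>\<infinity>m. 2 * ?g m) + (\<Sum>\<^sub>\<infinity>m. 2 * ?g m) = 4 * infsum ?g UNIV"
    by (simp only: infsum_cmult_right') simp
  finally have eq: "infsum ?f UNIV = 4 * infsum ?g UNIV" .
  have "- 2 * P * (4 * X) = 4 * \<i> * (2 * P * \<i> * X)" for P X :: complex by simp
  thus ?thesis
    unfolding theta_deriv_11[OF \<tau>4] theta_deriv_half_0[OF assms] eq by blast
qed

section \<open>Theta constants do not vanish\<close>

text \<open>
  The terms other than \<open>f 0\<close> have total size at most \<open>2 r / (1 - r)\<close> times \<open>norm (f 0)\<close>, and this factor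
  is less than 1 precisely when \<open>r < 1/3\<close>.
\<close>

lemma dominated_infsum_nonzero:
  fixes f :: "int \<Rightarrow> complex"
  assumes dom: "\<And>n. norm (f n) \<le> norm (f 0) * r ^ nat \<bar>n\<bar>"
    and "f 0 \<noteq> 0" "0 \<le> r" "r < 1/3"
  shows "infsum f UNIV \<noteq> 0"
proof
  assume 0: "infsum f UNIV = 0"
  have r: "((\<lambda>n::int. norm (f 0) * r ^ nat \<bar>n\<bar>) has_sum norm (f 0) * ((1 + r) / (1 - r))) UNIV"
    using assms by (intro has_sum_cmult_right has_sum_geometric_int) auto
  have "(\<lambda>n. norm (f n)) summable_on UNIV"
    using has_sum_imp_summable[OF r] dom by (rule Infinite_Sum.abs_summable_on_comparison_test')
  hence f0: "(f has_sum 0) UNIV"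
    using has_sum_infsum[of f UNIV] 0 by (simp add: abs_summable_summable)
  have f: "(f has_sum 0 - f 0) (UNIV - {0})"
    by (intro has_sum_Diff[OF f0] has_sum_finiteI) simp_all
  have "((\<lambda>n::int. norm (f 0) * r ^ nat \<bar>n\<bar>) has_sum norm (f 0) * ((1 + r) / (1 - r)) - norm (f 0)) (UNIV - {0})"
    by (intro has_sum_Diff[OF r] has_sum_finiteI) simp_all
  from norm_infsum_le[OF f this dom] have "norm (f 0) * 1 \<le> norm (f 0) * ((1 + r) / (1 - r) - 1)"
    by (simp add: algebra_simps)
  hence "1 \<le> (1 + r) / (1 - r) - 1"
    using \<open>f 0 \<noteq> 0\<close> by (subst (asm) mult_le_cancel_left_pos) auto
  thus False using assms by (simp add: field_simps)
qed

text \<open>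
  The bound on \<open>a\<close> makes \<open>(n + a)\<^sup>2 - a\<^sup>2 = n\<^sup>2 + 2 a n\<close> at least \<open>\<bar>n\<bar> / 2\<close>, so the term at \<open>n = 0\<close>
  dominates. At the shift \<open>1/2\<close> this would fail: there the terms at \<open>0\<close> and \<open>- 1\<close> have equal size.
\<close>

lemma gauss_series_nonzero:
  assumes "Im \<tau> \<ge> 2" "\<bar>a\<bar> \<le> 1/4" and c: "\<And>n. norm (c n) = 1"
  shows "(\<Sum>\<^sub>\<infinity>n. c n * gauss a \<tau> n) \<noteq> 0"
proof (rule dominated_infsum_nonzero)
  let ?r = "exp (- (pi * Im \<tau>) / 2)"
  fix n :: int
  have "\<bar>n\<bar> \<le> n\<^sup>2"
    using self_le_power[of "\<bar>n\<bar>" 2] by (cases "n = 0") auto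
  hence "\<bar>real_of_int n\<bar> \<le> (real_of_int n)\<^sup>2"
    by (metis of_int_abs of_int_le_iff of_int_power)
  moreover have "\<bar>2 * real_of_int n * a\<bar> \<le> \<bar>real_of_int n\<bar> / 2"
    using mult_right_mono[of "\<bar>2 * a\<bar>" "1/2" "\<bar>real_of_int n\<bar>"] assms(2) by (simp add: abs_mult mult_ac)
  ultimately have "a\<^sup>2 + \<bar>real_of_int n\<bar> / 2 \<le> (real_of_int n + a)\<^sup>2"
    unfolding power2_sum by linarith
  hence "(pi * Im \<tau>) * (a\<^sup>2 + \<bar>real_of_int n\<bar> / 2) \<le> (pi * Im \<tau>) * (real_of_int n + a)\<^sup>2"
    using assms(1) by (intro mult_left_mono) auto
  hence "norm (gauss a \<tau> n) \<le> exp (- (pi * Im \<tau>) * a\<^sup>2 + \<bar>real_of_int n\<bar> * (- (pi * Im \<tau>) / 2))"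
    unfolding norm_gauss exp_le_cancel_iff by (simp add: algebra_simps)
  also have "\<dots> = norm (gauss a \<tau> 0) * ?r ^ nat \<bar>n\<bar>"
    unfolding exp_add norm_gauss exp_of_nat_mult[symmetric] by simp
  finally show "norm (c n * gauss a \<tau> n) \<le> norm (c 0 * gauss a \<tau> 0) * ?r ^ nat \<bar>n\<bar>"
    by (simp add: norm_mult c)
next
  show "c 0 * gauss a \<tau> 0 \<noteq> 0"
    using c[of 0] by (auto simp: gauss_def)
  have "2 < pi * Im \<tau> / 2"
    using pi_gt3 mult_mono[of 3 pi 2 "Im \<tau>"] assms(1) by simp
  hence "3 < exp (pi * Im \<tau> / 2)"
    using exp_ge_add_one_self[of "pi * Im \<tau> / 2"] by linarith
  thus "exp (- (pi * Im \<tau>) / 2) < 1 / 3"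
    by (simp add: exp_minus field_simps)
qed auto

text \<open>
  A descent towards the cusp: by the doubling formulas, non-vanishing at \<open>2 \<tau>\<close> implies non-vanishing
  at \<open>\<tau>\<close>, and after sufficiently many doublings the imaginary part is so large that the leading term of
  each series dominates. For \<open>\<theta>[1,0]\<close>, whose series has two leading terms, the dominance argument is
  applied to the folded series \<open>\<theta>[1/2,0](4 \<tau>)\<close>.
\<close>

lemma theta_consts_nonzero:
  assumes "Im \<tau> > 0"
  shows "theta_const 1 0 \<tau> \<noteq> 0 \<and> theta_const 0 0 \<tau> \<noteq> 0 \<and> theta_const 0 1 \<tau> \<noteq> 0"
proof -
  have "theta_const 1 0 \<tau> \<noteq> 0 \<and> theta_const 0 0 \<tau> \<noteq> 0 \<and> theta_const 0 1 \<tau> \<noteq> 0"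
    if "Im \<tau> > 0" "2 \<le> 2 ^ k * Im \<tau>" for k \<tau>
    using that
  proof (induction k arbitrary: \<tau>)
    case 0
    hence 2: "Im \<tau> \<ge> 2" by simp
    have "theta_const (1/2) 0 (4 * \<tau>) \<noteq> 0"
      using gauss_series_nonzero[of "4 * \<tau>" "1/4" "\<lambda>_. 1"] 2 by (simp add: theta_half_0)
    moreover have "theta_const 0 0 \<tau> \<noteq> 0"
      using gauss_series_nonzero[of \<tau> 0 "\<lambda>_. 1"] 2 by (simp add: theta_00)
    moreover have "theta_const 0 1 \<tau> \<noteq> 0"
      using gauss_series_nonzero[of \<tau> 0 "\<lambda>n. (-1) powi n"] 2 by (simp add: theta_01)
    ultimately show ?case
      using theta_10_quarter[of "4 * \<tau>"] 0 by simp
  next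
    case (Suc k)
    have "theta_const 1 0 (2 * \<tau>) \<noteq> 0 \<and> theta_const 0 0 (2 * \<tau>) \<noteq> 0 \<and> theta_const 0 1 (2 * \<tau>) \<noteq> 0"
      using Suc.prems by (intro Suc.IH) (simp_all add: mult_ac)
    thus ?case
      using theta_10_squared[OF Suc.prems(1)] theta_00_times_01[OF Suc.prems(1)] by auto
  qed
  moreover obtain k where "2 / Im \<tau> < 2 ^ k"
    using real_arch_pow[of 2 "2 / Im \<tau>"] by auto
  hence "2 \<le> 2 ^ k * Im \<tau>" using assms by (simp add: field_simps)
  ultimately show ?thesis using assms by blast
qed

lemma theta_const_half_0_nonzero:
  assumes "Im \<tau> > 0"
  shows "theta_const (1/2) 0 \<tau> \<noteq> 0"
  using theta_consts_nonzero[of "\<tau> / 4"] theta_10_quarter[OF assms] assms by simp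

section \<open>The two identities with cleared denominators\<close>

lemma theta_deriv_half_0_times_cube:
  assumes "Im \<tau> > 0"
  shows "theta_deriv (1/2) 0 \<tau> * theta_const (1/2) 0 \<tau> ^ 3 =
    - \<i> / 4 * (theta_deriv 1 1 \<tau> * theta_const 0 1 \<tau> ^ 3)"
proof -
  have \<tau>4: "Im (\<tau> / 4) > 0" and four: "4 * (\<tau> / 4) = \<tau>" using assms by simp_all
  have alg: "A * B ^ 3 = - \<i> / 4 * (D * F ^ 3)"
    if *: "4 * \<i> * A * (2 * B) ^ 3 = 8 * D * F ^ 3" for A B D F :: complex
  proof -
    have "A * B ^ 3 = - \<i> / 32 * (4 * \<i> * A * (2 * B) ^ 3)" by (simp add: power_mult_distrib)
    thus ?thesis unfolding * by simp
  qed
  show ?thesis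
    using theta_deriv_11_times_10_cubed[OF \<tau>4]
    unfolding four theta_10_quarter[OF assms] theta_deriv_11_quarter[OF assms] by (rule alg)
qed

text \<open>
  The translation \<open>\<tau> \<mapsto> \<tau> + 2\<close> carries the characteristic \<open>[1/2,0]\<close> to \<open>[1/2,1]\<close>: up to the constant
  \<open>exp (\<pi> i / 8)\<close> it introduces the sign \<open>(-1)\<^sup>n\<close> into the terms with shift \<open>1/4\<close>. On the right-hand side
  it fixes \<open>\<theta>[0,1]\<close> and multiplies \<open>\<theta>'[1,1]\<close> by \<open>\<i>\<close>.
\<close>

lemma gauss_translate:
  "gauss a (\<tau> + 2) n = exp (2 * complex_of_real pi * \<i> * (of_int n + of_real a)\<^sup>2) * gauss a \<tau> n"
  unfolding gauss_def exp_add[symmetric] by (simp add: ring_distribs mult_ac add_ac)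

lemma exp_two_pi_i_int: "exp (2 * complex_of_real pi * \<i> * of_int k) = 1"
  using exp_pi_i_int[of "2 * k"] by (simp add: power_int_mult mult_ac)

lemma gauss_0_translate: "gauss 0 (\<tau> + 2) n = gauss 0 \<tau> n"
  unfolding gauss_translate using exp_two_pi_i_int[of "n\<^sup>2"] by simp

lemma gauss_half_translate: "gauss (1/2) (\<tau> + 2) n = \<i> * gauss (1/2) \<tau> n"
proof -
  have "exp (2 * complex_of_real pi * \<i> * (of_int n + of_real (1/2))\<^sup>2) =
      exp (2 * complex_of_real pi * \<i> * of_int (n\<^sup>2 + n)) * exp (complex_of_real pi * \<i> * (of_int 0 + 1 / 2))"
    unfolding exp_add[symmetric] by (rule arg_cong[of _ _ exp]) (simp add: power2_eq_square field_simps)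
  also have "\<dots> = \<i>" unfolding exp_two_pi_i_int exp_pi_i_half by simp
  finally show ?thesis unfolding gauss_translate by simp
qed

lemma gauss_quarter_translate:
  "exp (complex_of_real pi * \<i> / 8) * gauss (1/4) (\<tau> + 2) n =
     exp (complex_of_real pi * \<i> * (of_int n + 1/4)) * gauss (1/4) \<tau> n"
proof -
  have "exp (complex_of_real pi * \<i> / 8) * exp (2 * complex_of_real pi * \<i> * (of_int n + of_real (1/4))\<^sup>2) =
      exp (2 * complex_of_real pi * \<i> * of_int (n\<^sup>2)) * exp (complex_of_real pi * \<i> * (of_int n + 1/4))"
    unfolding exp_add[symmetric] by (rule arg_cong[of _ _ exp]) (simp add: power2_eq_square field_simps)
  thus ?thesis unfolding gauss_translate exp_two_pi_i_int by (simp add: mult.assoc[symmetric])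
qed

lemma theta_01_translate: "theta_const 0 1 (\<tau> + 2) = theta_const 0 1 \<tau>"
  by (simp add: theta_01 gauss_0_translate)

lemma theta_deriv_11_translate:
  assumes "Im \<tau> > 0"
  shows "theta_deriv 1 1 (\<tau> + 2) = \<i> * theta_deriv 1 1 \<tau>"
proof -
  have \<tau>2: "Im (\<tau> + 2) > 0" using assms by simp
  have "(\<Sum>\<^sub>\<infinity>n. (of_int n + 1/2) * (-1) powi n * gauss (1/2) (\<tau> + 2) n) =
      \<i> * (\<Sum>\<^sub>\<infinity>n. (of_int n + 1/2) * (-1) powi n * gauss (1/2) \<tau> n)"
    unfolding infsum_cmult_right'[symmetric] gauss_half_translate
    by (intro infsum_cong) (simp only: mult_ac)
  thus ?thesis
    unfolding theta_deriv_11[OF assms] theta_deriv_11[OF \<tau>2] by (simp only: mult_ac)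
qed

lemma theta_const_half_1:
  "theta_const (1/2) 1 \<tau> = exp (complex_of_real pi * \<i> / 8) * theta_const (1/2) 0 (\<tau> + 2)"
  unfolding theta_half_0 infsum_cmult_right'[symmetric] gauss_quarter_translate
  by (simp add: theta_const_series)

lemma theta_deriv_half_1:
  assumes "Im \<tau> > 0"
  shows "theta_deriv (1/2) 1 \<tau> = exp (complex_of_real pi * \<i> / 8) * theta_deriv (1/2) 0 (\<tau> + 2)"
proof -
  let ?w = "exp (complex_of_real pi * \<i> / 8)"
  have \<tau>2: "Im (\<tau> + 2) > 0" using assms by simp
  have "?w * (\<Sum>\<^sub>\<infinity>n. (of_int n + 1/4) * gauss (1/4) (\<tau> + 2) n) =
      (\<Sum>\<^sub>\<infinity>n. (of_int n + 1/4) * (?w * gauss (1/4) (\<tau> + 2) n))"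
    unfolding infsum_cmult_right'[symmetric] by (simp only: mult.left_commute)
  also have "\<dots> = (\<Sum>\<^sub>\<infinity>n. (of_int n + of_real (1/2) / 2) *
      exp (complex_of_real pi * \<i> * of_real 1 * (of_int n + of_real (1/2) / 2)) * gauss (1/2/2) \<tau> n)"
    unfolding gauss_quarter_translate by (simp add: mult.assoc)
  finally have eq: "?w * (\<Sum>\<^sub>\<infinity>n. (of_int n + 1/4) * gauss (1/4) (\<tau> + 2) n) = \<dots>" .
  have alg: "2 * P * \<i> * Y = w * (2 * P * \<i> * X)" if "w * X = Y" for P X Y w :: complex
    using that by auto
  show ?thesis
    unfolding theta_deriv_series[OF assms] theta_deriv_half_0[OF \<tau>2] by (rule alg[OF eq])
qed

text \<open>
  The identity for \<open>[1/2,0]\<close> taken at \<open>\<tau> + 2\<close>: the four factors \<open>exp (\<pi> i / 8)\<close> on the left multiply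
  to \<open>\<i>\<close>, and another \<open>\<i>\<close> comes from the translate of \<open>\<theta>'[1,1]\<close>.
\<close>

lemma theta_deriv_half_1_times_cube:
  assumes "Im \<tau> > 0"
  shows "theta_deriv (1/2) 1 \<tau> * theta_const (1/2) 1 \<tau> ^ 3 =
    \<i> / 4 * (theta_deriv 1 1 \<tau> * theta_const 0 1 \<tau> ^ 3)"
proof -
  let ?w = "exp (complex_of_real pi * \<i> / 8)"
  let ?A = "theta_deriv (1/2) 0 (\<tau> + 2)" and ?B = "theta_const (1/2) 0 (\<tau> + 2)"
  have "?w ^ 4 = exp (complex_of_real pi * \<i> * (of_int 0 + 1 / 2))"
    unfolding exp_of_nat_mult[symmetric] by (simp add: mult_ac)
  hence w: "?w ^ 4 = \<i>" unfolding exp_pi_i_half by simp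
  have "theta_deriv (1/2) 1 \<tau> * theta_const (1/2) 1 \<tau> ^ 3 = ?w ^ 4 * (?A * ?B ^ 3)"
    unfolding theta_deriv_half_1[OF assms] theta_const_half_1 by (simp only: power_mult_distrib power4_eq_xxxx power3_eq_cube mult_ac)
  also have "\<dots> = \<i> / 4 * (theta_deriv 1 1 \<tau> * theta_const 0 1 \<tau> ^ 3)"
    using theta_deriv_half_0_times_cube[of "\<tau> + 2"] assms
    by (simp add: w theta_01_translate theta_deriv_11_translate)
  finally show ?thesis .
qed

lemma root_zeta_4: "root_zeta 4 = \<i>"
  using exp_pi_i_half[of 0] by (simp add: root_zeta_def mult_ac)

theorem theorem3p2:
  fixes \<tau> :: complex
  assumes "Im \<tau> > 0"
  shows "theta_deriv (1/2) 1 \<tau> =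
           root_zeta 4 / 4 * (theta_deriv 1 1 \<tau> * theta_const 0 1 \<tau> ^ 3 / theta_const (1/2) 1 \<tau> ^ 3) \<and>
         theta_deriv (1/2) 0 \<tau> =
           root_zeta 4 ^ 3 / 4 * (theta_deriv 1 1 \<tau> * theta_const 0 1 \<tau> ^ 3 / theta_const (1/2) 0 \<tau> ^ 3)"
proof -
  have div: "A = c * (X / B ^ 3)" if "A * B ^ 3 = c * X" "B \<noteq> 0" for A B c X :: complex
    using that by (simp add: nonzero_eq_divide_eq)
  have "theta_const (1/2) 1 \<tau> \<noteq> 0"
    using theta_const_half_0_nonzero[of "\<tau> + 2"] assms by (simp add: theta_const_half_1)
  note 1 = div[OF theta_deriv_half_1_times_cube[OF assms] this]
  note 2 = div[OF theta_deriv_half_0_times_cube[OF assms] theta_const_half_0_nonzero[OF assms]]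
  have "root_zeta 4 ^ 3 = - \<i>" by (simp add: root_zeta_4 power3_eq_cube)
  with 1 2 show ?thesis unfolding root_zeta_4 by simp
qed

end
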